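(* Let $k\ge 1$ and $n\ge 0$ be integers, and let $m,\ell\ge 0$ and $0\le r\le k-1$ be integers such that $m=\ell k+r$. Then: (1) the $(r+1)$-tuple of statistics $(\mathrm{pk}^*_0,\dots,\mathrm{pk}^*_r)$ on $\mathcal{P}^{k,m}_n$ is jointly equidistributed with any of its permutations; (2) the $(k-r-1)$-tuple of statistics $(\mathrm{pk}^*_{r+1},\dots,\mathrm{pk}^*_{k-1})$ on $\mathcal{P}^{k,m}_n$ is jointly equidistributed with any of its permutations.
   Context: A $(k,m)$-ballot path of down-size $n$ is a lattice path from $(0,0)$ to $((k+1)n+m,m)$ with steps $u=(1,1)$ and $d=(1,-k)$ that stays in the first quadrant (never goes below the $x$-axis). $\mathcal{P}^{k,m}_n$ is the set of all such paths. A peak is a block of two consecutive steps $ud$; its height is the second coordinate of the left endpoint of its $d$ step. For $0\le i\le k-1$, $\mathrm{pk}^*_i(P)$ is the number of all peaks of $P$ (including the rightmost peak) whose height is congruent to $i$ modulo $k$. A tuple of statistics $(s_1,\dots,s_t)$ on a finite set $S$ is jointly equidistributed with any of its permutations if for every permutation $\sigma$ of $\{1,\dots,t\}$ and all integers $v_1,\dots,v_t$, the number of $P\in S$ with $s_j(P)=v_j$ for all $j$ equals the number of $P\in S$ with $s_{\sigma(j)}(P)=v_j$ for all $j$ (vacuous if $t=0$). *)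

theory Defs
  imports "HOL-Number_Theory.Cong" "HOL-Combinatorics.Permutations"
begin

datatype step = U | D

fun step_vec :: "nat \<Rightarrow> step \<Rightarrow> int \<times> int" where
  "step_vec k U = (1, 1)"
| "step_vec k D = (1, - int k)"

text \<open>A lattice path starting at the origin is represented by its list of steps.
  \<open>point k P j\<close> is the lattice point reached after the first \<open>j\<close> steps of \<open>P\<close>.\<close>

definition point :: "nat \<Rightarrow> step list \<Rightarrow> nat \<Rightarrow> int \<times> int" where
  "point k P j = (\<Sum>i<j. fst (step_vec k (P ! i)), \<Sum>i<j. snd (step_vec k (P ! i)))"

text \<open>Since steps are straight segments and the first quadrant is convex, a path stays in the
  first quadrant iff all its lattice points do.\<close>

definition ballot_paths :: "nat \<Rightarrow> nat \<Rightarrow> nat \<Rightarrow> step list set" where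
  "ballot_paths k m n =
     {P. point k P (length P) = (int ((k + 1) * n + m), int m) \<and>
         (\<forall>j\<le>length P. 0 \<le> fst (point k P j) \<and> 0 \<le> snd (point k P j))}"

text \<open>A peak is identified by the 0-based position \<open>j\<close> of its up step; the left endpoint of its
  down step is then the point reached after \<open>Suc j\<close> steps.\<close>

definition is_peak :: "step list \<Rightarrow> nat \<Rightarrow> bool" where
  "is_peak P j \<longleftrightarrow> Suc j < length P \<and> P ! j = U \<and> P ! Suc j = D"

definition peak_height :: "nat \<Rightarrow> step list \<Rightarrow> nat \<Rightarrow> int" where
  "peak_height k P j = snd (point k P (Suc j))"

definition pk_star :: "nat \<Rightarrow> nat \<Rightarrow> step list \<Rightarrow> nat" where
  "pk_star k i P = card {j. is_peak P j \<and> [peak_height k P j = int i] (mod int k)}"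

text \<open>A tuple of statistics is a list, with positions counted from 0. The notion is intended for
  finite \<open>S\<close>, since \<open>card\<close> is 0 on infinite sets; see \<open>finite_ballot_paths\<close> below.\<close>

definition jointly_equidistributed :: "'a set \<Rightarrow> ('a \<Rightarrow> nat) list \<Rightarrow> bool" where
  "jointly_equidistributed S ss \<longleftrightarrow>
     (\<forall>\<sigma> v. \<sigma> permutes {..<length ss} \<longrightarrow>
        card {P \<in> S. \<forall>j<length ss. int ((ss ! j) P) = (v :: nat \<Rightarrow> int) j} =
        card {P \<in> S. \<forall>j<length ss. int ((ss ! \<sigma> j) P) = v j})"

lemma finite_ballot_paths: "finite (ballot_paths k m n)"
proof (rule finite_subset)
  have fst_vec: "fst (step_vec k s) = 1" for s
    by (cases s) auto
  show "ballot_paths k m n \<subseteq> {P. set P \<subseteq> {U, D} \<and> length P = (k + 1) * n + m}"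
  proof
    fix P assume "P \<in> ballot_paths k m n"
    then have "int (length P) = int ((k + 1) * n + m)"
      unfolding ballot_paths_def point_def by (simp add: fst_vec)
    then have "length P = (k + 1) * n + m"
      by (simp only: of_nat_eq_iff)
    moreover have "set P \<subseteq> {U, D}"
      using step.exhaust by blast
    ultimately show "P \<in> {P. set P \<subseteq> {U, D} \<and> length P = (k + 1) * n + m}"
      by simp
  qed
  show "finite {P. set P \<subseteq> {U, D} \<and> length P = (k + 1) * n + m}"
    by (rule finite_lists_length_eq) simp
qed

end

theory Submission
  imports Defs "HOL-Computational_Algebra.Formal_Power_Series" "HOL-Library.Poly_Mapping"
begin

text \<open>Give each peak whose height has residue \<open>i\<close> modulo \<open>k\<close> the weight \<open>w i\<close>, and mark each
  down step by \<open>t\<close>. Cutting a path of final height \<open>m\<close> at its last visits to the heights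
  \<open>0, \<dots>, m - 1\<close> shows that its generating function is a product \<open>A\<^sub>0 A\<^sub>1 \<dots> A\<^sub>m\<close>, with indices
  read modulo \<open>k\<close>, where \<open>A\<^sub>i\<close> counts the paths of final height \<open>0\<close> lifted by \<open>i\<close>. Removing the
  last down step of such a path gives
    \<open>A\<^sub>i = 1 + t (A\<^sub>0 \<dots> A\<^bsub>k-1\<^esub>) (A\<^sub>i - 1 + w i)\<close>.
  This system is invariant under simultaneous permutations of the \<open>w i\<close> and the \<open>A\<^sub>i\<close>, so
  permuting the weights permutes the series \<open>A\<^sub>i\<close> (\<open>dyck_gf_permute\<close>). For \<open>m = l k + r\<close> the
  generating function is \<open>(A\<^sub>0 \<dots> A\<^bsub>k-1\<^esub>)\<^sup>l A\<^sub>0 \<dots> A\<^sub>r\<close>, which does not change under permutations of the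
  weights that preserve the set \<open>{0, \<dots>, r}\<close> (\<open>ballot_weight_permute\<close>).

  The cutting of paths is avoided as follows. Distinguishing the last step of a path gives a
  recursion for the total weights (\<open>ballot_weight_rec\<close>) that determines them, and the product
  \<open>A\<^sub>0 A\<^sub>1 \<dots> A\<^sub>m\<close> satisfies the same recursion as a consequence of the system for the \<open>A\<^sub>i\<close>
  (\<open>ballot_weight_eq_ballot_gf\<close>). Here the \<open>A\<^sub>i\<close> are obtained by iterating the system, which
  fixes one more coefficient in each round.

  Finally, with independent variables as weights, the coefficients of the total weight are the
  joint distribution of the peak statistics (\<open>lookup_ballot_weight_peak_var\<close>).\<close>

section \<open>Peak weights of ballot paths\<close>

text \<open>The product of the weights of all peaks of \<open>P\<close>, where a peak of height \<open>h\<close> has weight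
  \<open>w (h mod k)\<close>.\<close>

definition peak_weight :: "nat \<Rightarrow> (nat \<Rightarrow> 'a :: comm_ring_1) \<Rightarrow> step list \<Rightarrow> 'a" where
  "peak_weight k w P = (\<Prod>j | is_peak P j. w (nat (peak_height k P j mod int k)))"

text \<open>The total weight of the paths with final height \<open>m\<close> and \<open>n\<close> down steps.\<close>

definition ballot_weight :: "nat \<Rightarrow> (nat \<Rightarrow> 'a :: comm_ring_1) \<Rightarrow> nat \<Rightarrow> nat \<Rightarrow> 'a" where
  "ballot_weight k w m n = (\<Sum>P\<in>ballot_paths k m n. peak_weight k w P)"

lemma finite_peaks [simp]: "finite {j. is_peak P j}"
  by (rule finite_subset[of _ "{..<length P}"]) (auto simp: is_peak_def)

lemma fst_step_vec [simp]: "fst (step_vec k s) = 1"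
  by (cases s) auto

lemma fst_point [simp]: "fst (point k P j) = int j"
  by (simp add: point_def)

lemma point_append: "j \<le> length Q \<Longrightarrow> point k (Q @ R) j = point k Q j"
  by (auto simp: point_def nth_append intro!: sum.cong)

lemma snd_point_snoc:
  "snd (point k (Q @ [s]) (Suc (length Q))) = snd (point k Q (length Q)) + snd (step_vec k s)"
  using point_append[of "length Q" Q k "[s]"] by (simp add: point_def)

lemma snd_point_le: "snd (point k P j) \<le> int j"
proof -
  have "snd (step_vec k s) \<le> 1" for s
    by (cases s) auto
  then have "(\<Sum>i<j. snd (step_vec k (P ! i))) \<le> (\<Sum>i<j. 1)"
    by (intro sum_mono) auto
  then show ?thesis
    by (simp add: point_def)
qed

lemma ballot_paths_iff:
  "P \<in> ballot_paths k m n \<longleftrightarrow>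
     length P = (k + 1) * n + m \<and> snd (point k P (length P)) = int m \<and>
     (\<forall>j\<le>length P. 0 \<le> snd (point k P j))"
proof -
  have "int (length P) = int ((k + 1) * n + m) \<longleftrightarrow> length P = (k + 1) * n + m"
    by (simp only: of_nat_eq_iff)
  then show ?thesis
    by (auto simp: ballot_paths_def prod_eq_iff simp del: of_nat_add of_nat_mult)
qed

lemma Nil_in_ballot_paths: "[] \<in> ballot_paths k m n \<longleftrightarrow> m = 0 \<and> n = 0"
  by (auto simp: ballot_paths_iff point_def)

lemma all_point_snoc:
  "(\<forall>j\<le>length (Q @ [s]). 0 \<le> snd (point k (Q @ [s]) j)) \<longleftrightarrow>
     (\<forall>j\<le>length Q. 0 \<le> snd (point k Q j)) \<and>
     0 \<le> snd (point k Q (length Q)) + snd (step_vec k s)"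
  by (auto simp: le_Suc_eq point_append snd_point_snoc)

lemma snoc_U_in_ballot_paths:
  "Q @ [U] \<in> ballot_paths k m n \<longleftrightarrow> m > 0 \<and> Q \<in> ballot_paths k (m - 1) n"
  unfolding ballot_paths_iff all_point_snoc
  by (cases m) (auto simp: snd_point_snoc)

lemma snoc_D_in_ballot_paths:
  "Q @ [D] \<in> ballot_paths k m n \<longleftrightarrow> n > 0 \<and> Q \<in> ballot_paths k (m + k) (n - 1)"
  unfolding ballot_paths_iff all_point_snoc
  using snd_point_le[of k Q "length Q"]
  by (cases n) (auto simp: snd_point_snoc)

lemma step_list_cases:
  obtains "P = []" | Q where "P = Q @ [U]" | Q where "P = Q @ [D]"
  by (metis rev_exhaust step.exhaust)

lemma peak_weight_Nil [simp]: "peak_weight k w [] = 1"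
  by (simp add: peak_weight_def is_peak_def)

lemma peak_height_append: "is_peak Q j \<Longrightarrow> peak_height k (Q @ R) j = peak_height k Q j"
  by (simp add: peak_height_def is_peak_def point_append)

lemma peak_weight_append_eq:
  assumes "{j. is_peak (Q @ R) j} = {j. is_peak Q j}"
  shows "peak_weight k w (Q @ R) = peak_weight k w Q"
  unfolding peak_weight_def assms by (rule prod.cong) (auto simp: peak_height_append)

lemma peak_weight_snoc_U [simp]: "peak_weight k w (Q @ [U]) = peak_weight k w Q"
  by (rule peak_weight_append_eq) (auto simp: is_peak_def nth_append less_Suc_eq)

lemma peak_weight_snoc_DD: "peak_weight k w ((Q @ [D]) @ [D]) = peak_weight k w (Q @ [D])"
  by (rule peak_weight_append_eq) (auto simp: is_peak_def nth_append less_Suc_eq)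

lemma peak_weight_snoc_UD:
  "peak_weight k w ((Q @ [U]) @ [D]) =
     peak_weight k w (Q @ [U]) * w (nat (snd (point k (Q @ [U]) (length (Q @ [U]))) mod int k))"
proof -
  have peaks: "{j. is_peak ((Q @ [U]) @ [D]) j} = insert (length Q) {j. is_peak Q j}"
    by (auto simp: is_peak_def nth_append less_Suc_eq split: if_splits)
  have last: "peak_height k ((Q @ [U]) @ [D]) (length Q) =
      snd (point k (Q @ [U]) (length (Q @ [U])))"
    unfolding peak_height_def by (subst point_append) auto
  have "peak_weight k w ((Q @ [U]) @ [D]) =
      w (nat (snd (point k (Q @ [U]) (length (Q @ [U]))) mod int k)) *
      (\<Prod>j | is_peak Q j. w (nat (peak_height k ((Q @ [U]) @ [D]) j mod int k)))"
    unfolding peak_weight_def peaks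
    by (subst prod.insert) (simp_all only: last, simp_all add: is_peak_def)
  also have "(\<Prod>j | is_peak Q j. w (nat (peak_height k ((Q @ [U]) @ [D]) j mod int k))) =
      peak_weight k w Q"
    unfolding peak_weight_def by (rule prod.cong) (simp_all add: peak_height_append)
  finally show ?thesis
    by (simp add: mult.commute)
qed

lemma sum_ballot_paths_split:
  "sum f (ballot_paths k m n) =
     (if m = 0 \<and> n = 0 then f [] else 0) +
     (if m = 0 then 0 else \<Sum>Q\<in>ballot_paths k (m - 1) n. f (Q @ [U])) +
     (if n = 0 then 0 else \<Sum>Q\<in>ballot_paths k (m + k) (n - 1). f (Q @ [D]))"
  for f :: "step list \<Rightarrow> 'a :: comm_monoid_add"
proof -
  define E where "E = (if m = 0 \<and> n = 0 then {[]} else ({} :: step list set))"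
  define EU where "EU = (if m = 0 then {} else (\<lambda>Q. Q @ [U]) ` ballot_paths k (m - 1) n)"
  define ED where "ED = (if n = 0 then {} else (\<lambda>Q. Q @ [D]) ` ballot_paths k (m + k) (n - 1))"
  have "P \<in> ballot_paths k m n \<longleftrightarrow> P \<in> E \<union> EU \<union> ED" for P
    by (cases P rule: step_list_cases)
      (auto simp: E_def EU_def ED_def Nil_in_ballot_paths snoc_U_in_ballot_paths
        snoc_D_in_ballot_paths)
  then have split: "ballot_paths k m n = E \<union> EU \<union> ED"
    by blast
  have fin: "finite E" "finite EU" "finite ED"
    by (auto simp: E_def EU_def ED_def finite_ballot_paths)
  have "sum f (ballot_paths k m n) = sum f (E \<union> EU) + sum f ED"
    unfolding split using fin
    by (intro sum.union_disjoint) (auto simp: E_def EU_def ED_def)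
  also have "sum f (E \<union> EU) = sum f E + sum f EU"
    using fin by (intro sum.union_disjoint) (auto simp: E_def EU_def)
  finally show ?thesis
    by (simp add: E_def EU_def ED_def sum.reindex inj_on_def)
qed

text \<open>Appending a down step creates a peak exactly when the last step goes up. The paths whose
  last step goes up have total weight \<open>ballot_weight k w (m - 1) n\<close>, and for them the weight is
  multiplied by \<open>w (m mod k)\<close>. The assumption \<open>m > 0\<close> excludes the empty path.\<close>

lemma ballot_weight_snoc_D:
  fixes w :: "nat \<Rightarrow> 'a :: comm_ring_1"
  assumes "m > 0"
  shows "(\<Sum>Q\<in>ballot_paths k m n. peak_weight k w (Q @ [D])) =
    ballot_weight k w m n + (w (m mod k) - 1) * ballot_weight k w (m - 1) n"
proof -
  have UD: "peak_weight k w ((Q @ [U]) @ [D]) = w (m mod k) * peak_weight k w Q"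
    if "Q \<in> ballot_paths k (m - 1) n" for Q
  proof -
    have "Q @ [U] \<in> ballot_paths k m n"
      using that assms by (simp add: snoc_U_in_ballot_paths)
    then have "snd (point k (Q @ [U]) (length (Q @ [U]))) = int m"
      unfolding ballot_paths_iff by blast
    then show ?thesis
      unfolding peak_weight_snoc_UD by (simp add: nat_mod_distrib mult.commute)
  qed
  show ?thesis
    unfolding ballot_weight_def
      sum_ballot_paths_split[where f = "\<lambda>Q. peak_weight k w (Q @ [D])" and m = m]
      sum_ballot_paths_split[where f = "peak_weight k w" and m = m]
    using assms
    by (simp add: UD peak_weight_snoc_DD algebra_simps sum_distrib_left sum_subtractf
        cong: sum.cong del: append_assoc)
qed

text \<open>The first summand counts the empty path and the paths ending with an up step, the second
  one those ending with a down step, which starts at height \<open>m + k\<close>.\<close>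

lemma ballot_weight_rec:
  fixes w :: "nat \<Rightarrow> 'a :: comm_ring_1"
  assumes "k > 0"
  shows "ballot_weight k w m n =
     (if m = 0 then if n = 0 then 1 else 0 else ballot_weight k w (m - 1) n) +
     (if n = 0 then 0 else ballot_weight k w (m + k) (n - 1) +
        (w (m mod k) - 1) * ballot_weight k w (m + k - 1) (n - 1))"
  using ballot_weight_snoc_D[of "m + k" k w "n - 1"] assms
  unfolding ballot_weight_def[of k w m n] sum_ballot_paths_split[of _ k m n]
  by (simp add: ballot_weight_def)

section \<open>Product formula for the generating function\<close>

text \<open>The \<open>N\<close>-th iterate, started from \<open>1\<close>, of the system
  \<open>A\<^sub>i = 1 + X (A\<^sub>0 \<dots> A\<^bsub>k-1\<^esub>) (A\<^sub>i - 1 + w i)\<close>. For \<open>i < k\<close>, its coefficients up to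
  \<open>X ^ N\<close> are those of the solution, the generating function of the paths of final height \<open>0\<close> lifted by \<open>i\<close>, counted
  by down steps; later coefficients have no meaning.\<close>

primrec dyck_gf :: "nat \<Rightarrow> (nat \<Rightarrow> 'a :: comm_ring_1) \<Rightarrow> nat \<Rightarrow> nat \<Rightarrow> 'a fps" where
  "dyck_gf k w 0 i = 1"
| "dyck_gf k w (Suc N) i =
     1 + fps_X * ((\<Prod>j<k. dyck_gf k w N j) * (dyck_gf k w N i - 1 + fps_const (w i)))"

text \<open>A product of \<open>m\<close> factors: for \<open>m > 0\<close> it is, up to \<open>X ^ N\<close>, the generating function of the
  paths of final height \<open>m - 1\<close>. With this shift of the index, the empty product is available as the initial
  value of the recursion in \<open>m\<close>.\<close>

definition ballot_gf :: "nat \<Rightarrow> (nat \<Rightarrow> 'a :: comm_ring_1) \<Rightarrow> nat \<Rightarrow> nat \<Rightarrow> 'a fps" where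
  "ballot_gf k w N m = (\<Prod>i<m. dyck_gf k w N (i mod k))"

text \<open>Congruence of power series modulo \<open>X ^ n\<close>.\<close>

definition fps_agree :: "nat \<Rightarrow> 'a :: comm_ring_1 fps \<Rightarrow> 'a fps \<Rightarrow> bool" where
  "fps_agree n f g \<longleftrightarrow> (\<forall>m<n. fps_nth f m = fps_nth g m)"

lemma fps_agree_refl [simp]: "fps_agree n f f"
  by (simp add: fps_agree_def)

lemma fps_agree_mult:
  "fps_agree n f f' \<Longrightarrow> fps_agree n g g' \<Longrightarrow> fps_agree n (f * g) (f' * g')"
  unfolding fps_agree_def fps_mult_nth by (auto intro!: sum.cong)

lemma fps_agree_add:
  "fps_agree n f f' \<Longrightarrow> fps_agree n g g' \<Longrightarrow> fps_agree n (f + g) (f' + g')"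
  by (simp add: fps_agree_def)

lemma fps_agree_diff:
  "fps_agree n f f' \<Longrightarrow> fps_agree n g g' \<Longrightarrow> fps_agree n (f - g) (f' - g')"
  by (simp add: fps_agree_def)

lemma fps_agree_prod:
  "(\<And>i. i \<in> I \<Longrightarrow> fps_agree n (f i) (g i)) \<Longrightarrow> fps_agree n (prod f I) (prod g I)"
  by (induction I rule: infinite_finite_induct) (auto intro: fps_agree_mult)

lemma fps_agree_X_mult:
  "fps_agree n f g \<Longrightarrow> fps_agree (Suc n) (fps_X * f) (fps_X * g)"
  by (auto simp: fps_agree_def)

lemma dyck_gf_agree: "fps_agree (Suc N) (dyck_gf k w N i) (dyck_gf k w (Suc N) i)"
proof (induction N arbitrary: i)
  case 0
  show ?case
    by (simp add: fps_agree_def)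
next
  case (Suc N)
  have "fps_agree (Suc (Suc N))
      (1 + fps_X * ((\<Prod>j<k. dyck_gf k w N j) * (dyck_gf k w N i - 1 + fps_const (w i))))
      (1 + fps_X * ((\<Prod>j<k. dyck_gf k w (Suc N) j) *
        (dyck_gf k w (Suc N) i - 1 + fps_const (w i))))"
    by (intro fps_agree_add fps_agree_X_mult fps_agree_mult fps_agree_prod fps_agree_diff
        fps_agree_refl Suc.IH)
  then show ?case
    by (simp only: dyck_gf.simps(2))
qed

text \<open>Any \<open>k\<close> consecutive factors run through all residues modulo \<open>k\<close>.\<close>

lemma ballot_gf_add: "ballot_gf k w N (m + k) = ballot_gf k w N m * (\<Prod>j<k. dyck_gf k w N j)"
proof (induction m)
  case 0
  show ?case
    by (auto simp: ballot_gf_def intro: prod.cong)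
next
  case (Suc m)
  then show ?case
    by (simp add: ballot_gf_def mult_ac)
qed

text \<open>The recursion of \<open>ballot_weight_rec\<close> for the products, modulo \<open>X ^ (N + 1)\<close>: the last factor
  of the product is replaced by the right-hand side of its defining system.\<close>

lemma ballot_gf_rec:
  "fps_agree (Suc N) (ballot_gf k w N (Suc m))
     (ballot_gf k w N m + fps_X * (ballot_gf k w N (Suc m + k) +
        fps_const (w (m mod k) - 1) * ballot_gf k w N (m + k)))"
proof -
  let ?A = "dyck_gf k w"
  have "fps_agree (Suc N) (ballot_gf k w N m * ?A N (m mod k))
      (ballot_gf k w N m * ?A (Suc N) (m mod k))"
    by (intro fps_agree_mult fps_agree_refl dyck_gf_agree)
  also have "ballot_gf k w N m * ?A N (m mod k) = ballot_gf k w N (Suc m)"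
    by (simp add: ballot_gf_def)
  also have "ballot_gf k w N m * ?A (Suc N) (m mod k) = ballot_gf k w N m +
      fps_X * (ballot_gf k w N (Suc m + k) +
        fps_const (w (m mod k) - 1) * ballot_gf k w N (m + k))"
    unfolding ballot_gf_add
    by (simp add: ballot_gf_def algebra_simps flip: fps_const_sub)
  finally show ?thesis .
qed

theorem ballot_weight_eq_ballot_gf:
  fixes w :: "nat \<Rightarrow> 'a :: comm_ring_1"
  assumes "k > 0" and "n \<le> N"
  shows "ballot_weight k w m n = fps_nth (ballot_gf k w N (Suc m)) n"
  using \<open>n \<le> N\<close>
proof (induction n arbitrary: m)
  case 0
  show ?case
  proof (induction m)
    case 0
    show ?case
      using ballot_gf_rec[of N k w 0] ballot_weight_rec[OF assms(1), of w 0 0]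
      by (simp add: fps_agree_def ballot_gf_def)
  next
    case (Suc m)
    then show ?case
      using ballot_gf_rec[of N k w "Suc m"] ballot_weight_rec[OF assms(1), of w "Suc m" 0]
      by (simp add: fps_agree_def)
  qed
next
  case (Suc n)
  have *: "ballot_weight k w (m + k) n = fps_nth (ballot_gf k w N (Suc m + k)) n"
    "ballot_weight k w (m + k - 1) n = fps_nth (ballot_gf k w N (m + k)) n" for m
    using Suc.IH[of "m + k"] Suc.IH[of "m + k - 1"] Suc.prems assms(1) by simp_all
  have rec: "fps_nth (ballot_gf k w N (Suc m)) (Suc n) =
      fps_nth (ballot_gf k w N m) (Suc n) + (fps_nth (ballot_gf k w N (Suc m + k)) n +
        (w (m mod k) - 1) * fps_nth (ballot_gf k w N (m + k)) n)" for m
    using ballot_gf_rec[of N k w m] Suc.prems by (simp add: fps_agree_def del: fps_const_sub)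
  show ?case
  proof (induction m)
    case 0
    show ?case
      using rec[of 0] ballot_weight_rec[OF assms(1), of w 0 "Suc n"] *[of 0]
      by (simp add: ballot_gf_def[of k w N 0])
  next
    case (Suc m)
    then show ?case
      using rec[of "Suc m"] ballot_weight_rec[OF assms(1), of w "Suc m" "Suc n"] *[of "Suc m"]
      by simp
  qed
qed

section \<open>Symmetry of the weight\<close>

lemma dyck_gf_permute:
  assumes "\<pi> permutes {..<k}"
  shows "dyck_gf k (w \<circ> \<pi>) N i = dyck_gf k w N (\<pi> i)"
proof (induction N arbitrary: i)
  case (Suc N)
  then show ?case
    using prod.permute[OF assms, of "dyck_gf k w N"] by (simp add: o_def)
qed simp

lemma ballot_gf_mult_add:
  assumes "r < k"
  shows "ballot_gf k w N (l * k + Suc r) =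
    (\<Prod>j<k. dyck_gf k w N j) ^ l * (\<Prod>i\<le>r. dyck_gf k w N i)"
proof (induction l)
  case 0
  have "i mod k = i" if "i \<le> r" for i
    using that assms by simp
  then show ?case
    by (auto simp: ballot_gf_def lessThan_Suc_atMost intro: prod.cong)
next
  case (Suc l)
  then show ?case
    using ballot_gf_add[of k w N "l * k + Suc r"] by (simp add: algebra_simps)
qed

text \<open>The weights are permuted within \<open>{0, \<dots>, r}\<close> and within \<open>{r + 1, \<dots>, k - 1}\<close>.\<close>

lemma ballot_weight_permute:
  fixes w :: "nat \<Rightarrow> 'a :: comm_ring_1"
  assumes "r < k" and "\<pi> permutes {..<k}" and "\<pi> ` {..r} = {..r}"
  shows "ballot_weight k (w \<circ> \<pi>) (l * k + r) n = ballot_weight k w (l * k + r) n"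
proof -
  have "(\<Prod>j<k. dyck_gf k (w \<circ> \<pi>) n j) = (\<Prod>j<k. dyck_gf k w n j)"
    unfolding dyck_gf_permute[OF assms(2)]
    using prod.permute[OF assms(2), of "dyck_gf k w n"] by (simp add: o_def)
  moreover have "(\<Prod>i\<le>r. dyck_gf k (w \<circ> \<pi>) n i) = (\<Prod>i\<le>r. dyck_gf k w n i)"
    using prod.reindex[of \<pi> "{..r}" "dyck_gf k w n"] permutes_inj_on[OF assms(2), of "{..r}"]
      assms(3)
    unfolding dyck_gf_permute[OF assms(2)] by (simp add: o_def)
  ultimately have "ballot_gf k (w \<circ> \<pi>) n (l * k + Suc r) = ballot_gf k w n (l * k + Suc r)"
    by (simp only: ballot_gf_mult_add[OF assms(1)])
  then show ?thesis
    using assms(1) by (simp add: ballot_weight_eq_ballot_gf[where N = n])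
qed

section \<open>From weights to joint distributions\<close>

text \<open>Weights in the ring of Laurent polynomials over the integers, whose elements are finitely
  supported maps from exponent vectors to coefficients: residues \<open>i\<close> in \<open>B\<close> have the variable with
  index \<open>g i\<close> as weight, and peaks of any other residue are not recorded. Exponents are integers
  because the values prescribed in \<open>jointly_equidistributed\<close> are.\<close>

definition peak_var ::
    "nat set \<Rightarrow> (nat \<Rightarrow> nat) \<Rightarrow> nat \<Rightarrow> (nat \<Rightarrow>\<^sub>0 int) \<Rightarrow>\<^sub>0 int" where
  "peak_var B g i = (if i \<in> B then Poly_Mapping.single (Poly_Mapping.single (g i) 1) 1 else 1)"

lemma prod_single:
  "(\<Prod>i\<in>I. Poly_Mapping.single (f i) (1 :: 'b :: comm_semiring_1)) =
     Poly_Mapping.single (\<Sum>i\<in>I. f i :: 'a :: comm_monoid_add) 1"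
  by (induction I rule: infinite_finite_induct) (auto simp: mult_single)

lemma pk_star_eq_card:
  assumes "i < k"
  shows "pk_star k i P = card {j. is_peak P j \<and> nat (peak_height k P j mod int k) = i}"
proof -
  have "[h = int i] (mod int k) \<longleftrightarrow> nat (h mod int k) = i" for h
    using assms by (auto simp: cong_def)
  then show ?thesis
    by (simp add: pk_star_def)
qed

lemma peak_weight_peak_var:
  assumes "B \<subseteq> {..<k}"
  shows "peak_weight k (peak_var B g) P =
    Poly_Mapping.single (\<Sum>i\<in>B. Poly_Mapping.single (g i) (int (pk_star k i P))) 1"
proof -
  define h where "h j = nat (peak_height k P j mod int k)" for j
  define X :: "nat \<Rightarrow> nat \<Rightarrow>\<^sub>0 int" where "X i = Poly_Mapping.single (g i) 1" for i
  have fin: "finite B"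
    using assms finite_subset by blast
  have "peak_weight k (peak_var B g) P =
      (\<Prod>j | is_peak P j. Poly_Mapping.single (if h j \<in> B then X (h j) else 0) 1)"
    by (auto simp: peak_weight_def peak_var_def h_def X_def intro!: prod.cong)
  also have "\<dots> = Poly_Mapping.single (\<Sum>j | is_peak P j. if h j \<in> B then X (h j) else 0) 1"
    by (rule prod_single)
  also have "(\<Sum>j | is_peak P j. if h j \<in> B then X (h j) else 0) =
      (\<Sum>j | is_peak P j. \<Sum>i\<in>B. if h j = i then X i else 0)"
    using fin by (simp add: sum.delta)
  also have "\<dots> = (\<Sum>i\<in>B. \<Sum>j | is_peak P j. if h j = i then X i else 0)"
    by (rule sum.swap)
  also have "\<dots> = (\<Sum>i\<in>B. Poly_Mapping.single (g i) (int (pk_star k i P)))"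
  proof (rule sum.cong)
    fix i assume "i \<in> B"
    then have "i < k"
      using assms by auto
    have "(\<Sum>j | is_peak P j. if h j = i then X i else 0) =
        (\<Sum>j | is_peak P j \<and> h j = i. X i)"
      by (simp add: sum.inter_filter[symmetric])
    also have "\<dots> = Poly_Mapping.single (g i) (\<Sum>j | is_peak P j \<and> h j = i. 1)"
      unfolding X_def
      by (rule poly_mapping_eqI) (simp add: lookup_sum lookup_single when_def del: sum_constant)
    also have "(\<Sum>j | is_peak P j \<and> h j = i. 1) = int (pk_star k i P)"
      using \<open>i < k\<close> by (simp add: pk_star_eq_card h_def)
    finally show "(\<Sum>j | is_peak P j. if h j = i then X i else 0) =
        Poly_Mapping.single (g i) (int (pk_star k i P))" .
  qed simp
  finally show ?thesis .
qed

lemma sum_single_eq_iff: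
  fixes a b :: "'i \<Rightarrow> 'b :: comm_monoid_add"
  assumes "finite B" and "inj_on g B"
  shows "(\<Sum>i\<in>B. Poly_Mapping.single (g i) (a i)) = (\<Sum>i\<in>B. Poly_Mapping.single (g i) (b i)) \<longleftrightarrow>
    (\<forall>i\<in>B. a i = b i)"
proof -
  have lookup: "Poly_Mapping.lookup (\<Sum>i\<in>B. Poly_Mapping.single (g i) (c i)) (g j) = c j"
    if "j \<in> B" for j and c :: "'i \<Rightarrow> 'b"
  proof -
    have "Poly_Mapping.lookup (\<Sum>i\<in>B. Poly_Mapping.single (g i) (c i)) (g j) =
        (\<Sum>i\<in>B. if i = j then c i else 0)"
      unfolding lookup_sum lookup_single
      using that assms(2) by (intro sum.cong) (auto simp: when_def inj_on_def)
    then show ?thesis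
      using that assms(1) by simp
  qed
  show ?thesis
    by (metis (no_types, lifting) lookup sum.cong)
qed

lemma lookup_ballot_weight_peak_var:
  assumes "B \<subseteq> {..<k}" and "inj_on g B"
  shows "Poly_Mapping.lookup (ballot_weight k (peak_var B g) m n)
      (\<Sum>i\<in>B. Poly_Mapping.single (g i) (u i)) =
    int (card {P \<in> ballot_paths k m n. \<forall>i\<in>B. int (pk_star k i P) = u i})"
proof -
  have fin: "finite B"
    using assms(1) finite_subset by blast
  show ?thesis
    unfolding ballot_weight_def
    by (simp add: lookup_sum peak_weight_peak_var[OF assms(1)] lookup_single when_def
        sum_single_eq_iff[OF fin assms(2)] finite_ballot_paths eq_commute[of "u i" for i]
        flip: sum.inter_filter)
qed

lemma card_pk_star_permute:
  assumes "r < k" and "B \<subseteq> {..r} \<or> B \<subseteq> {r<..<k}" and "\<pi> permutes B"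
  shows "card {P \<in> ballot_paths k (l * k + r) n. \<forall>i\<in>B. int (pk_star k i P) = u (\<pi> i)} =
    card {P \<in> ballot_paths k (l * k + r) n. \<forall>i\<in>B. int (pk_star k i P) = u i}"
proof -
  have B: "B \<subseteq> {..<k}"
    using assms(1,2) by auto
  have \<pi>: "\<pi> permutes {..<k}"
    using assms(3) B by (rule permutes_subset)
  have "\<pi> ` {..r} = {..r}"
  proof (cases "B \<subseteq> {..r}")
    case True
    with assms(3) have "\<pi> permutes {..r}"
      by (rule permutes_subset)
    then show ?thesis
      by (rule permutes_image)
  next
    case False
    with assms(2) have "\<pi> i = i" if "i \<le> r" for i
      using that assms(3) by (auto simp: permutes_def)
    then show ?thesis
      by simp
  qed
  then have "ballot_weight k (peak_var B id \<circ> \<pi>) (l * k + r) n =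
      ballot_weight k (peak_var B id) (l * k + r) n"
    by (rule ballot_weight_permute[OF assms(1) \<pi>])
  moreover have "peak_var B id \<circ> \<pi> = peak_var B \<pi>"
    using permutes_in_image[OF assms(3)] by (auto simp: peak_var_def)
  moreover have "(\<Sum>i\<in>B. Poly_Mapping.single (\<pi> i) (u (\<pi> i))) =
      (\<Sum>i\<in>B. Poly_Mapping.single (id i) (u i))"
    using sum.permute[OF assms(3), of "\<lambda>i. Poly_Mapping.single i (u i)"] by (simp add: o_def)
  ultimately have "int (card {P \<in> ballot_paths k (l * k + r) n.
        \<forall>i\<in>B. int (pk_star k i P) = u (\<pi> i)}) =
      int (card {P \<in> ballot_paths k (l * k + r) n. \<forall>i\<in>B. int (pk_star k i P) = u i})"
    using lookup_ballot_weight_peak_var[OF B permutes_inj_on[OF assms(3)],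
        where u = "u \<circ> \<pi>" and m = "l * k + r" and n = n]
      lookup_ballot_weight_peak_var[OF B, of id, where u = u and m = "l * k + r" and n = n]
    by simp
  then show ?thesis
    by simp
qed

lemma jointly_equidistributed_pk_star:
  assumes "r < k" and "{a..<b} \<subseteq> {..r} \<or> {a..<b} \<subseteq> {r<..<k}"
  shows "jointly_equidistributed (ballot_paths k (l * k + r) n) (map (pk_star k) [a..<b])"
  unfolding jointly_equidistributed_def
proof (intro allI impI)
  fix \<sigma> and v :: "nat \<Rightarrow> int"
  assume "\<sigma> permutes {..<length (map (pk_star k) [a..<b])}"
  then have \<sigma>: "\<sigma> permutes {..<b - a}"
    by simp
  \<comment> \<open>The statistic at position \<open>\<sigma> j\<close> has to take the value \<open>v j\<close>, so the value prescribed at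
    position \<open>j\<close> is \<open>v (inv \<sigma> j)\<close>. Hence \<open>inv \<sigma>\<close>, shifted by \<open>a\<close>, permutes the residues.\<close>
  define \<pi> where "\<pi> i = (if i \<in> {a..<b} then a + inv \<sigma> (i - a) else i)" for i
  have inv: "inv \<sigma> permutes {..<b - a}"
    by (rule permutes_inv[OF \<sigma>])
  have in_block: "a + inv \<sigma> (i - a) \<in> {a..<b}" if "i \<in> {a..<b}" for i
    using that permutes_in_image[OF inv, of "i - a"] by auto
  have "inj_on \<pi> {a..<b}"
    by (rule inj_onI) (use permutes_inj[OF inv] in \<open>auto simp: \<pi>_def dest: injD\<close>)
  moreover have "\<pi> ` {a..<b} \<subseteq> {a..<b}"
    using in_block by (auto simp: \<pi>_def)
  ultimately have "bij_betw \<pi> {a..<b} {a..<b}"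
    by (simp add: bij_betw_def endo_inj_surj)
  then have \<pi>: "\<pi> permutes {a..<b}"
    by (rule bij_imp_permutes) (auto simp: \<pi>_def)
  have block: "(\<forall>i\<in>{a..<b}. Q i) \<longleftrightarrow> (\<forall>j<b - a. Q (a + j))" for Q
  proof (intro iffI ballI)
    fix i assume "\<forall>j<b - a. Q (a + j)" and "i \<in> {a..<b}"
    then have "Q (a + (i - a))"
      by (metis atLeastLessThan_iff diff_less_mono)
    with \<open>i \<in> {a..<b}\<close> show "Q i"
      by simp
  qed auto
  have "(\<forall>i\<in>{a..<b}. int (pk_star k i P) = v (\<pi> i - a)) \<longleftrightarrow>
      (\<forall>j<b - a. int (pk_star k (a + \<sigma> j) P) = v j)" for P
  proof -
    have "(\<forall>i\<in>{a..<b}. int (pk_star k i P) = v (\<pi> i - a)) \<longleftrightarrow>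
        (\<forall>j\<in>{..<b - a}. int (pk_star k (a + j) P) = v (inv \<sigma> j))"
      unfolding block by (auto simp: \<pi>_def)
    also have "\<dots> \<longleftrightarrow> (\<forall>j\<in>\<sigma> ` {..<b - a}. int (pk_star k (a + j) P) = v (inv \<sigma> j))"
      by (simp only: permutes_image[OF \<sigma>])
    finally show ?thesis
      by (simp add: permutes_inverses[OF \<sigma>], simp add: Ball_def)
  qed
  moreover have "(\<forall>i\<in>{a..<b}. int (pk_star k i P) = v (i - a)) \<longleftrightarrow>
      (\<forall>j<b - a. int (pk_star k (a + j) P) = v j)" for P
    unfolding block by simp
  moreover have "a + \<sigma> j < b" if "j < b - a" for j
    using that permutes_in_image[OF \<sigma>, of j] by auto
  ultimately show "card {P \<in> ballot_paths k (l * k + r) n.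
        \<forall>j<length (map (pk_star k) [a..<b]). int ((map (pk_star k) [a..<b] ! j) P) = v j} =
      card {P \<in> ballot_paths k (l * k + r) n.
        \<forall>j<length (map (pk_star k) [a..<b]). int ((map (pk_star k) [a..<b] ! \<sigma> j) P) = v j}"
    using card_pk_star_permute[OF assms \<pi>, of l n "\<lambda>i. v (i - a)"] permutes_in_image[OF \<sigma>]
    by (simp cong: conj_cong)
qed

theorem theorem3p3:
  fixes k n m l r :: nat
  assumes "k \<ge> 1" and "r \<le> k - 1" and "m = l * k + r"
  shows "jointly_equidistributed (ballot_paths k m n) (map (pk_star k) [0..<r + 1]) \<and>
         jointly_equidistributed (ballot_paths k m n) (map (pk_star k) [r + 1..<k])"
proof -
  have "r < k"
    using assms(1,2) by simp
  then show ?thesis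
    unfolding assms(3) by (intro conjI jointly_equidistributed_pk_star) auto
qed

end
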